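(* Let $0<q<1$. For every positive integer $n$, $$\sum_{j=1}^{n} q^{\binom{n+1}{2}-\binom{j+1}{2}}\,[j]_q\,[j^2]_q = \left(\left[\binom{n+1}{2}\right]_q\right)^2 .$$
   Context: For a real number $0<p<1$ and a nonnegative integer $m$, $[m]_p = \frac{1-p^m}{1-p} = 1+p+\cdots+p^{m-1}$ (so $[0]_p=0$). Here $\binom{m}{2}=\frac{m(m-1)}{2}$ is the ordinary binomial coefficient, and $\left[\binom{n+1}{2}\right]_q$ denotes the $q$-number $[m]_q$ with $m=\binom{n+1}{2}$ (not a $q$-binomial coefficient). *)

theory Defs
  imports Complex_Main
begin

definition q_number :: "real \<Rightarrow> nat \<Rightarrow> real" where
  "q_number p m = (1 - p ^ m) / (1 - p)"

end

theory Submission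
  imports Defs
begin

text \<open>
  Induction on n, with [k] for the q-number of k. Writing T for the triangular number (n + 1 choose 2) and m = n + 1, the
  sum S satisfies S (n + 1) = q ^ m * S n + [m] * [m ^ 2], since the next triangular number is
  T + m. As m ^ 2 = 2 * T + m, the claim for n + 1 is the identity
  q ^ m * [T] ^ 2 + [m] * [2 * T + m] = [T + m] ^ 2, valid for arbitrary T and m:
  multiplied by (1 - q) ^ 2, it becomes a polynomial identity in q ^ T and q ^ m.
\<close>

text \<open>No condition on q is needed: division by zero yields zero, so at q = 1 both sides vanish.\<close>

lemma q_number_add_squared:
  "(q_number q (t + m))\<^sup>2 = q ^ m * (q_number q t)\<^sup>2 + q_number q m * q_number q (2 * t + m)"
proof -
  define a b where "a = q ^ t" and "b = q ^ m"
  have pow: "q ^ (t + m) = a * b" "q ^ (2 * t + m) = a * a * b"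
    by (simp_all add: a_def b_def power_add mult_2)
  have "(1 - a * b)\<^sup>2 = b * (1 - a)\<^sup>2 + (1 - b) * (1 - a * a * b)"
    by (simp add: power2_eq_square algebra_simps)
  then have "(1 - a * b)\<^sup>2 / (1 - q)\<^sup>2
      = b * ((1 - a)\<^sup>2 / (1 - q)\<^sup>2) + (1 - b) * (1 - a * a * b) / (1 - q)\<^sup>2"
    by (simp add: add_divide_distrib)
  then show ?thesis
    unfolding q_number_def pow a_def[symmetric] b_def[symmetric] power_divide
    by (simp add: power2_eq_square)
qed

lemma Suc_squared_eq_triangular: "(Suc n)\<^sup>2 = 2 * (Suc n choose 2) + Suc n"
proof -
  have "2 * (Suc n choose 2) = Suc n * n"
    by (simp add: choose_two)
  then show ?thesis
    by (simp add: power2_eq_square)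
qed

lemma sum_q_cubes:
  "(\<Sum>j=1..n. q ^ ((n + 1 choose 2) - (j + 1 choose 2)) * q_number q j * q_number q (j\<^sup>2))
     = (q_number q (n + 1 choose 2))\<^sup>2"
proof (induction n)
  case 0
  show ?case
    by (simp add: q_number_def binomial_eq_0)
next
  case (Suc n)
  define t where "t = (n + 1 choose 2)"
  have tri: "(Suc n + 1 choose 2) = t + Suc n"
    by (simp add: t_def numeral_2_eq_2)
  have "q ^ (t + Suc n - (j + 1 choose 2)) = q ^ Suc n * q ^ (t - (j + 1 choose 2))"
    if "j \<in> {1..n}" for j
  proof -
    \<comment> \<open>The exponents are truncated differences, so monotonicity of the triangular numbers matters.\<close>
    have "(j + 1 choose 2) \<le> t"
      using that unfolding t_def choose_two by (intro div_le_mono mult_le_mono) auto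
    then have "t + Suc n - (j + 1 choose 2) = Suc n + (t - (j + 1 choose 2))"
      by simp
    then show ?thesis
      by (simp only: power_add)
  qed
  then have "(\<Sum>j=1..n. q ^ (t + Suc n - (j + 1 choose 2)) * q_number q j * q_number q (j\<^sup>2))
      = q ^ Suc n * (\<Sum>j=1..n. q ^ (t - (j + 1 choose 2)) * q_number q j * q_number q (j\<^sup>2))"
    unfolding sum_distrib_left by (intro sum.cong) (simp_all only: mult.assoc)
  also have "\<dots> = q ^ Suc n * (q_number q t)\<^sup>2"
    using Suc.IH by (simp only: t_def)
  finally have "(\<Sum>j=1..Suc n. q ^ (t + Suc n - (j + 1 choose 2)) * q_number q j * q_number q (j\<^sup>2))
      = q ^ Suc n * (q_number q t)\<^sup>2 + q_number q (Suc n) * q_number q ((Suc n)\<^sup>2)"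
    using tri by simp
  also have "(Suc n)\<^sup>2 = 2 * t + Suc n"
    using Suc_squared_eq_triangular[of n] by (simp only: t_def Suc_eq_plus1)
  finally show ?case
    unfolding tri q_number_add_squared .
qed

theorem theorem1:
  fixes q :: real and n :: nat
  assumes "0 < q" and "q < 1" and "n \<ge> 1"
  shows "(\<Sum>j=1..n. q ^ ((n + 1 choose 2) - (j + 1 choose 2)) * q_number q j * q_number q (j\<^sup>2))
           = (q_number q (n + 1 choose 2))\<^sup>2"
  by (rule sum_q_cubes)

end
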